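(* Let $H(z)\in\mathbb{C}[[z]]^{\times n}$ with $o(H(z))\ge 2$, and let $N_t(z)=\sum_{m=1}^\infty t^{m-1}N_{[m]}(z)$ be the unique solution of the Cauchy problem $$\frac{\partial N_t}{\partial t}=JN_t\cdot N_t,\qquad N_{t=0}(z)=H(z).$$ Then $$N_{[1]}=H,\qquad N_{[m]}=\frac{1}{m-1}\sum_{\substack{k+l=m\\ k,l\ge 1}}JN_{[k]}\cdot N_{[l]}\quad\text{for any } m\ge 2.$$
   Context: $z=(z_1,\dots,z_n)$; $t$ is a formal parameter. Elements of $\mathbb{C}[[z]]^{\times n}$ are column vectors of $n$ formal power series. $o(H(z))\ge 2$ means every monomial occurring in any component of $H$ has total degree at least $2$. For a vector $U$ of series, $JU=(\partial U_i/\partial z_j)_{i,j}$ is the Jacobian matrix with respect to $z$; $JU\cdot V$ is the matrix-vector product. Solutions of the Cauchy problem are understood as ($n$-vectors of) formal power series in $t$ and $z$, and $N_{[m]}(z)\in\mathbb{C}[[z]]^{\times n}$ is the coefficient of $t^{m-1}$ in $N_t(z)$. *)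

theory Defs
  imports "HOL-Analysis.Analysis" "HOL-Computational_Algebra.Formal_Power_Series"
begin

text \<open>
  Formal power series in finitely many variables indexed by \<open>'n\<close>, with coefficients in \<open>'a\<close>.
  A monomial \<open>z\<^sup>e\<close> is represented by its exponent vector \<open>e :: nat^'n\<close>.
\<close>

typedef ('a, 'n::finite) mfps = "UNIV :: (nat^'n \<Rightarrow> 'a) set"
  morphisms mfps_nth Abs_mfps by simp

setup_lifting type_definition_mfps

lemma mfps_eqI: "(\<And>e. mfps_nth f e = mfps_nth g e) \<Longrightarrow> f = g"
  by transfer auto

lemma finite_exponents_le: "finite {a :: nat^'n. a \<le> e}"
proof -
  have "{a :: nat^'n. a \<le> e} \<subseteq> vec_lambda ` (PiE UNIV (\<lambda>i. {..e $ i}))"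
  proof
    fix a :: "nat^'n" assume "a \<in> {a. a \<le> e}"
    then have "vec_nth a \<in> PiE UNIV (\<lambda>i. {..e $ i})"
      by (auto simp: less_eq_vec_def)
    then show "a \<in> vec_lambda ` (PiE UNIV (\<lambda>i. {..e $ i}))"
      by (metis imageI vec_nth_inverse)
  qed
  then show ?thesis
    by (rule finite_subset) (intro finite_imageI finite_PiE, auto)
qed

lemma finite_exponent_splits [simp]: "finite {(a, b). a + b = (e :: nat^'n)}"
proof (rule finite_subset)
  show "{(a, b). a + b = e} \<subseteq> {a. a \<le> e} \<times> {b. b \<le> e}"
    by (auto simp: less_eq_vec_def)
qed (intro finite_cartesian_product finite_exponents_le)

instantiation mfps :: (comm_ring_1, finite) comm_ring_1
begin

lift_definition zero_mfps :: "('a, 'b) mfps" is "\<lambda>_. 0" .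
lift_definition one_mfps :: "('a, 'b) mfps" is "\<lambda>e. if e = 0 then 1 else 0" .
lift_definition plus_mfps :: "('a, 'b) mfps \<Rightarrow> ('a, 'b) mfps \<Rightarrow> ('a, 'b) mfps"
  is "\<lambda>f g e. f e + g e" .
lift_definition minus_mfps :: "('a, 'b) mfps \<Rightarrow> ('a, 'b) mfps \<Rightarrow> ('a, 'b) mfps"
  is "\<lambda>f g e. f e - g e" .
lift_definition uminus_mfps :: "('a, 'b) mfps \<Rightarrow> ('a, 'b) mfps"
  is "\<lambda>f e. - f e" .
lift_definition times_mfps :: "('a, 'b) mfps \<Rightarrow> ('a, 'b) mfps \<Rightarrow> ('a, 'b) mfps"
  is "\<lambda>f g e. \<Sum>(a, b) \<in> {(a, b). a + b = e}. f a * g b" .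

instance
proof
  fix f g h :: "('a, 'b) mfps"
  show "f * g * h = f * (g * h)"
  proof transfer
    fix f g h :: "nat^'b \<Rightarrow> 'a"
    show "(\<lambda>e. \<Sum>(p, c) \<in> {(p, c). p + c = e}. (\<Sum>(a, b) \<in> {(a, b). a + b = p}. f a * g b) * h c) =
          (\<lambda>e. \<Sum>(a, q) \<in> {(a, q). a + q = e}. f a * (\<Sum>(b, c) \<in> {(b, c). b + c = q}. g b * h c))"
    proof
      fix e :: "nat^'b"
      have "(\<Sum>(p, c) \<in> {(p, c). p + c = e}. (\<Sum>(a, b) \<in> {(a, b). a + b = p}. f a * g b) * h c) =
            (\<Sum>x \<in> {(p, c). p + c = e}. \<Sum>y \<in> {(a, b). a + b = fst x}.
               f (fst y) * g (snd y) * h (snd x))"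
        by (simp add: case_prod_unfold sum_distrib_right)
      also have "\<dots> = (\<Sum>(x, y) \<in> Sigma {(p, c). p + c = e} (\<lambda>x. {(a, b). a + b = fst x}).
               f (fst y) * g (snd y) * h (snd x))"
        by (subst sum.Sigma) auto
      also have "\<dots> = (\<Sum>(x, y) \<in> Sigma {(a, q). a + q = e} (\<lambda>x. {(b, c). b + c = snd x}).
               f (fst x) * (g (fst y) * h (snd y)))"
        by (rule sum.reindex_bij_witness
              [where i = "\<lambda>((a, q), (b, c)). ((a + b, c), (a, b))"
                 and j = "\<lambda>((p, c), (a, b)). ((a, b + c), (b, c))"])
           (auto simp: algebra_simps)
      also have "\<dots> = (\<Sum>x \<in> {(a, q). a + q = e}. \<Sum>y \<in> {(b, c). b + c = snd x}.
               f (fst x) * (g (fst y) * h (snd y)))"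
        by (subst sum.Sigma) auto
      also have "\<dots> = (\<Sum>(a, q) \<in> {(a, q). a + q = e}.
               f a * (\<Sum>(b, c) \<in> {(b, c). b + c = q}. g b * h c))"
        by (simp add: case_prod_unfold sum_distrib_left)
      finally show "(\<Sum>(p, c) \<in> {(p, c). p + c = e}. (\<Sum>(a, b) \<in> {(a, b). a + b = p}. f a * g b) * h c) =
          (\<Sum>(a, q) \<in> {(a, q). a + q = e}. f a * (\<Sum>(b, c) \<in> {(b, c). b + c = q}. g b * h c))" .
    qed
  qed
  show "f * g = g * f"
  proof transfer
    fix f g :: "nat^'b \<Rightarrow> 'a"
    show "(\<lambda>e. \<Sum>(a, b) \<in> {(a, b). a + b = e}. f a * g b) =
          (\<lambda>e. \<Sum>(a, b) \<in> {(a, b). a + b = e}. g a * f b)"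
      by (rule ext, rule sum.reindex_bij_witness
            [where i = "\<lambda>(a, b). (b, a)" and j = "\<lambda>(a, b). (b, a)"])
         (auto simp: algebra_simps)
  qed
  show "1 * f = f"
  proof transfer
    fix f :: "nat^'b \<Rightarrow> 'a"
    show "(\<lambda>e. \<Sum>(a, b) \<in> {(a, b). a + b = e}. (if a = 0 then 1 else 0) * f b) = f"
    proof
      fix e :: "nat^'b"
      have "(\<Sum>(a, b) \<in> {(a, b). a + b = e}. (if a = 0 then 1 else 0) * f b) =
            (\<Sum>(a, b) \<in> {(0 :: nat^'b, e)}. (if a = 0 then 1 else 0) * f b)"
        by (rule sum.mono_neutral_right) (auto split: if_splits)
      then show "(\<Sum>(a, b) \<in> {(a, b). a + b = e}. (if a = 0 then 1 else 0) * f b) = f e"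
        by simp
    qed
  qed
  show "(f + g) * h = f * h + g * h"
    by transfer (auto simp: fun_eq_iff case_prod_unfold algebra_simps sum.distrib)
  show "(0 :: ('a, 'b) mfps) \<noteq> 1"
    by transfer (auto simp: fun_eq_iff)
qed (transfer; auto simp: fun_eq_iff algebra_simps)+

end

lift_definition mfps_const :: "'a::zero \<Rightarrow> ('a, 'n::finite) mfps"
  is "\<lambda>c e. if e = 0 then c else 0" .

text \<open>
  The partial derivative with respect to \<open>z\<^sub>j\<close>; the exponent vector of the variable \<open>z\<^sub>j\<close> is
  \<open>axis j 1\<close>.
\<close>

lift_definition mfps_pderiv ::
    "'n \<Rightarrow> ('a::semiring_1, 'n::finite) mfps \<Rightarrow> ('a, 'n) mfps"
  is "\<lambda>j f e. of_nat (e $ j + 1) * f (e + axis j 1)" .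

definition mfps_jacobian :: "('a::semiring_1, 'n::finite) mfps ^ 'n \<Rightarrow> ('a, 'n) mfps ^ 'n ^ 'n"
  where "mfps_jacobian U = (\<chi> i j. mfps_pderiv j (U $ i))"

text \<open>\<open>order_at_least d H\<close> expresses \<open>o(H(z)) \<ge> d\<close>; in particular it holds for \<open>H = 0\<close>.\<close>

definition order_at_least :: "nat \<Rightarrow> ('a::zero, 'n::finite) mfps ^ 'n \<Rightarrow> bool"
  where "order_at_least d H \<longleftrightarrow>
    (\<forall>i e. mfps_nth (H $ i) e \<noteq> 0 \<longrightarrow> d \<le> (\<Sum>j\<in>UNIV. e $ j))"

text \<open>
  Formal power series in \<open>t\<close> and \<open>z\<close> are elements of \<open>\<complex>[[z]][[t]]\<close>, i.e. of type
  \<open>(complex, 'n) mfps fps\<close>.  Derivatives in \<open>z\<close> act on the coefficients of the powers of \<open>t\<close>.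
\<close>

definition fps_mfps_pderiv ::
    "'n \<Rightarrow> ('a::semiring_1, 'n::finite) mfps fps \<Rightarrow> ('a, 'n) mfps fps"
  where "fps_mfps_pderiv j F = Abs_fps (\<lambda>k. mfps_pderiv j (fps_nth F k))"

definition fps_mfps_jacobian ::
    "('a::semiring_1, 'n::finite) mfps fps ^ 'n \<Rightarrow> ('a, 'n) mfps fps ^ 'n ^ 'n"
  where "fps_mfps_jacobian U = (\<chi> i j. fps_mfps_pderiv j (U $ i))"

definition cauchy_solution ::
    "(complex, 'n::finite) mfps ^ 'n \<Rightarrow> (complex, 'n) mfps fps ^ 'n \<Rightarrow> bool"
  where "cauchy_solution H N \<longleftrightarrow>
    (\<chi> i. fps_deriv (N $ i)) = fps_mfps_jacobian N *v N \<and>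
    (\<chi> i. fps_nth (N $ i) 0) = H"

text \<open>
  The vector \<open>N\<^bsub>[m]\<^esub>(z)\<close>, the coefficient of \<open>t\<^bsup>m-1\<^esup>\<close>; meaningful for \<open>m \<ge> 1\<close> only.
\<close>

definition t_coeff ::
    "('a, 'n::finite) mfps fps ^ 'n \<Rightarrow> nat \<Rightarrow> ('a, 'n) mfps ^ 'n"
  where "t_coeff N m = (\<chi> i. fps_nth (N $ i) (m - 1))"

end

theory Submission
  imports Defs
begin

text \<open>
  The derivative \<open>\<partial>/\<partial>t\<close> multiplies the coefficient of \<open>t\<^bsup>n+1\<^esup>\<close> by \<open>n + 1\<close> and moves it to \<open>t\<^sup>n\<close>,
  while the product \<open>JN\<^sub>t \<cdot> N\<^sub>t\<close> has the Cauchy convolution of the coefficients at \<open>t\<^sup>n\<close>, because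
  \<open>J\<close> acts coefficientwise in \<open>t\<close>.  Since \<open>n + 1\<close> is a unit in the coefficient ring, comparing
  coefficients shows that the Cauchy problem is \<^emph>\<open>equivalent\<close> to the recursion
  (\<open>cauchy_solution_iff_recursion\<close>).  Its right-hand side at index \<open>m\<close> involves only smaller
  indices.  Hence the recursion has exactly one solution, which gives existence and uniqueness,
  and the recursion itself is the formula for \<open>N\<^bsub>[m]\<^esub>\<close>.
\<close>

lemma mfps_nth_const_mult:
  fixes f :: "('a::comm_ring_1, 'n::finite) mfps"
  shows "mfps_nth (mfps_const c * f) e = c * mfps_nth f e"
proof transfer
  fix c :: 'a and f :: "nat^'n \<Rightarrow> 'a" and e :: "nat^'n"
  have "(\<Sum>(a, b) \<in> {(a, b). a + b = e}. (if a = 0 then c else 0) * f b) =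
        (\<Sum>(a, b) \<in> {(0 :: nat^'n, e)}. (if a = 0 then c else 0) * f b)"
    by (rule sum.mono_neutral_right) (auto split: if_splits)
  then show "(\<Sum>(a, b) \<in> {(a, b). a + b = e}. (if a = 0 then c else 0) * f b) = c * f e"
    by simp
qed

lemma of_nat_eq_mfps_const:
  "of_nat k = (mfps_const (of_nat k) :: ('a::comm_ring_1, 'n::finite) mfps)"
proof (induction k)
  case 0
  show ?case by (rule mfps_eqI) (simp add: mfps_const.rep_eq zero_mfps.rep_eq)
next
  case (Suc k)
  show ?case
    unfolding of_nat_Suc Suc
    by (rule mfps_eqI) (simp add: mfps_const.rep_eq one_mfps.rep_eq plus_mfps.rep_eq)
qed

text \<open>
  In characteristic \<open>0\<close> a nonzero integer is a unit of the power series ring, with constant inverse;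
  this is what allows solving for the next coefficient of a derivative.
\<close>

lemma of_nat_mult_eq_iff_mfps:
  fixes f g :: "('a::field_char_0, 'n::finite) mfps"
  assumes "k \<noteq> 0"
  shows "of_nat k * f = g \<longleftrightarrow> f = mfps_const (1 / of_nat k) * g"
proof -
  have "of_nat k * f = g \<longleftrightarrow> (\<forall>e. of_nat k * mfps_nth f e = mfps_nth g e)"
    by (metis mfps_eqI mfps_nth_const_mult of_nat_eq_mfps_const)
  also have "\<dots> \<longleftrightarrow> (\<forall>e. mfps_nth f e = 1 / of_nat k * mfps_nth g e)"
    using assms by (simp add: field_simps)
  also have "\<dots> \<longleftrightarrow> f = mfps_const (1 / of_nat k) * g"
    by (metis mfps_eqI mfps_nth_const_mult)
  finally show ?thesis .
qed

lemma t_coeff_Suc_nth: "t_coeff N (Suc n) $ i = fps_nth (N $ i) n"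
  by (simp add: t_coeff_def)

lemma eq_if_t_coeff_eq:
  assumes "\<And>n. t_coeff M (Suc n) = t_coeff N (Suc n)"
  shows "M = N"
  using assms by (metis fps_eq_iff t_coeff_Suc_nth vec_eq_iff)

lemma fps_nth_jacobian_mult:
  fixes N :: "('a::comm_ring_1, 'n::finite) mfps fps ^ 'n"
  shows "fps_nth ((fps_mfps_jacobian N *v N) $ i) n =
    (\<Sum>a=0..n. mfps_jacobian (t_coeff N (Suc a)) *v t_coeff N (Suc (n - a))) $ i"
  by (simp add: matrix_vector_mult_def fps_mfps_jacobian_def fps_mfps_pderiv_def
      mfps_jacobian_def t_coeff_Suc_nth fps_sum_nth fps_mult_nth)
    (rule sum.swap)

lemma cauchy_solution_iff_recursion:
  fixes H :: "(complex, 'n::finite) mfps ^ 'n"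
  shows "cauchy_solution H N \<longleftrightarrow> t_coeff N (Suc 0) = H \<and>
    (\<forall>n. t_coeff N (Suc (Suc n)) = mfps_const (1 / of_nat (Suc n)) *s
      (\<Sum>a=0..n. mfps_jacobian (t_coeff N (Suc a)) *v t_coeff N (Suc (n - a))))"
    (is "_ \<longleftrightarrow> _ \<and> (\<forall>n. _ = _ *s ?S n)")
proof -
  have "(\<chi> i. fps_deriv (N $ i)) = fps_mfps_jacobian N *v N \<longleftrightarrow>
      (\<forall>n i. of_nat (Suc n) * t_coeff N (Suc (Suc n)) $ i = ?S n $ i)"
    by (simp add: vec_eq_iff fps_eq_iff fps_nth_jacobian_mult t_coeff_Suc_nth
        del: sum_component of_nat_Suc) blast
  also have "\<dots> \<longleftrightarrow>
      (\<forall>n. t_coeff N (Suc (Suc n)) = mfps_const (1 / of_nat (Suc n)) *s ?S n)"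
    by (simp add: of_nat_mult_eq_iff_mfps vec_eq_iff del: sum_component of_nat_Suc)
  finally show ?thesis
    by (auto simp: cauchy_solution_def t_coeff_def)
qed

text \<open>
  The vector with index \<open>n\<close> is the coefficient of \<open>t\<^sup>n\<close>, that is \<open>N\<^bsub>[n+1]\<^esub>\<close>: counting from \<open>0\<close>
  lets the recursion run over all of \<open>nat\<close>.
\<close>

fun cauchy_coeff ::
    "(complex, 'n::finite) mfps ^ 'n \<Rightarrow> nat \<Rightarrow> (complex, 'n) mfps ^ 'n" where
  "cauchy_coeff H 0 = H"
| "cauchy_coeff H (Suc n) = mfps_const (1 / of_nat (Suc n)) *s
    (\<Sum>a=0..n. mfps_jacobian (cauchy_coeff H a) *v cauchy_coeff H (n - a))"

text \<open>
  Uniqueness and existence in one: a formal power series is the same as an arbitrary sequence of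
  coefficients, so exactly one \<open>N\<close> satisfies the right-hand side.
\<close>

lemma cauchy_solution_iff_cauchy_coeff:
  "cauchy_solution H N \<longleftrightarrow> (\<forall>n. t_coeff N (Suc n) = cauchy_coeff H n)"
proof
  assume sol: "cauchy_solution H N"
  have "t_coeff N (Suc n) = cauchy_coeff H n" for n
  proof (induction n rule: less_induct)
    case (less n)
    show ?case
    proof (cases n)
      case 0
      with sol show ?thesis by (simp add: cauchy_solution_iff_recursion)
    next
      case (Suc k)
      have "mfps_jacobian (t_coeff N (Suc a)) *v t_coeff N (Suc (k - a)) =
          mfps_jacobian (cauchy_coeff H a) *v cauchy_coeff H (k - a)" if "a \<in> {0..k}" for a
        using that less Suc by simp
      then have "(\<Sum>a=0..k. mfps_jacobian (t_coeff N (Suc a)) *v t_coeff N (Suc (k - a))) =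
          (\<Sum>a=0..k. mfps_jacobian (cauchy_coeff H a) *v cauchy_coeff H (k - a))"
        by (rule sum.cong[OF refl])
      with sol Suc show ?thesis
        by (simp add: cauchy_solution_iff_recursion)
    qed
  qed
  then show "\<forall>n. t_coeff N (Suc n) = cauchy_coeff H n" ..
next
  assume "\<forall>n. t_coeff N (Suc n) = cauchy_coeff H n"
  then show "cauchy_solution H N"
    by (simp add: cauchy_solution_iff_recursion)
qed

lemma ex1_cauchy_solution: "\<exists>!N. cauchy_solution H N"
proof -
  have "t_coeff (\<chi> i. Abs_fps (\<lambda>n. cauchy_coeff H n $ i)) (Suc n) = cauchy_coeff H n" for n
    by (simp add: t_coeff_def)
  then show ?thesis
    unfolding cauchy_solution_iff_cauchy_coeff
    by (metis eq_if_t_coeff_eq)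
qed

lemma sum_positive_pairs_eq_sum_shifted:
  fixes F :: "nat \<Rightarrow> nat \<Rightarrow> 'a::comm_monoid_add"
  shows "(\<Sum>(k, l) \<in> {(k, l). k + l = Suc (Suc n) \<and> 1 \<le> k \<and> 1 \<le> l}. F k l) =
    (\<Sum>a=0..n. F (Suc a) (Suc (n - a)))"
  by (rule sum.reindex_bij_witness
        [where i = "\<lambda>a. (Suc a, Suc (n - a))" and j = "\<lambda>(k, l). k - 1"])
    (auto simp: Suc_diff_le intro!: arg_cong2[where f = F])

theorem proposition3p3:
  fixes H :: "(complex, 'n::finite) mfps ^ 'n"
  assumes "order_at_least 2 H"
  shows "(\<exists>!N. cauchy_solution H N) \<and>
    (\<forall>N. cauchy_solution H N \<longrightarrow>
      t_coeff N 1 = H \<and>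
      (\<forall>m\<ge>2. t_coeff N m =
        mfps_const (1 / (of_nat m - 1)) *s
          (\<Sum>(k, l) \<in> {(k, l). k + l = m \<and> 1 \<le> k \<and> 1 \<le> l}.
             mfps_jacobian (t_coeff N k) *v t_coeff N l)))"
proof (intro conjI allI impI)
  show "\<exists>!N. cauchy_solution H N"
    by (rule ex1_cauchy_solution)
next
  fix N assume "cauchy_solution H N"
  then show "t_coeff N 1 = H"
    by (simp add: cauchy_solution_iff_recursion)
next
  fix N and m :: nat
  assume sol: "cauchy_solution H N" and "2 \<le> m"
  then obtain n where m: "m = Suc (Suc n)"
    by (metis Suc_le_D Suc_le_mono numeral_2_eq_2)
  have "of_nat m - 1 = (of_nat (Suc n) :: complex)"
    by (simp add: m)
  with sol show "t_coeff N m = mfps_const (1 / (of_nat m - 1)) *s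
      (\<Sum>(k, l) \<in> {(k, l). k + l = m \<and> 1 \<le> k \<and> 1 \<le> l}.
         mfps_jacobian (t_coeff N k) *v t_coeff N l)"
    unfolding cauchy_solution_iff_recursion m sum_positive_pairs_eq_sum_shifted by metis
qed

end
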